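(* Let $T$ be a tree on $n$ vertices with diameter $D\geq 5$ and let $P=v_0v_1\ldots v_D$ be a diametric path such that $M(v_2)/\deg(v_1)\leq M(v_{D-2})/\deg(v_{D-1})$. Let $w_1,\ldots,w_k$ be all pendant vertices (leaves) adjacent to $v_1$. Let $T'$ be the tree obtained from $T$ by deleting the edges $v_1w_1,\ldots,v_1w_k$ and adding the edges $v_{D-1}w_1,\ldots,v_{D-1}w_k$. Then $\xi^{ac}(T)<\xi^{ac}(T')$.
   Context: $d(u,v)$ is the distance, $\varepsilon(u)=\max_v d(u,v)$ the eccentricity, and the diameter $D$ the maximum distance in the tree; a path $v_0\ldots v_D$ with $d(v_0,v_D)=D$ is diametric. $\deg(u)$ is the degree of $u$, $M(u)$ is the product of the degrees of all neighbors of $u$, and $\xi^{ac}(G)=\sum_{u\in V(G)}\frac{M(u)}{\varepsilon(u)}$. *)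

theory Defs
  imports Complex_Main "Graph_Theory.Graph_Theory"
begin

text \<open>
  Finite simple undirected graphs are the library's \<open>pair_graph\<close>s: finite, loop-free, symmetric
  arc relations, an edge \<open>uv\<close> being the two arcs \<open>(u,v)\<close> and \<open>(v,u)\<close>.
  The library predicate \<open>tree\<close> is not usable on them: its \<open>forest\<close> also forbids the directed
  2-cycle \<open>u v u\<close> that every undirected edge gives rise to. Hence only cycles of length at
  least 3, which are the cycles of the undirected graph, are excluded here.
\<close>

definition undirected_tree :: "'a pair_pre_digraph \<Rightarrow> bool" where
  "undirected_tree G \<longleftrightarrow>
     pair_graph G \<and> connected (with_proj G) \<and>
     \<not> (\<exists>p. pre_digraph.cycle (with_proj G) p \<and> length p \<ge> 3)"

definition vdist :: "'a pair_pre_digraph \<Rightarrow> 'a \<Rightarrow> 'a \<Rightarrow> nat" where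
  "vdist G u v = (LEAST k. \<exists>p. pre_digraph.awalk (with_proj G) u p v \<and> length p = k)"

definition ecc :: "'a pair_pre_digraph \<Rightarrow> 'a \<Rightarrow> nat" where
  "ecc G u = Max {vdist G u v | v. v \<in> pverts G}"

definition diam :: "'a pair_pre_digraph \<Rightarrow> nat" where
  "diam G = Max {vdist G u v | u v. u \<in> pverts G \<and> v \<in> pverts G}"

definition diametric_path :: "'a pair_pre_digraph \<Rightarrow> 'a list \<Rightarrow> bool" where
  "diametric_path G P \<longleftrightarrow>
     vpath P (with_proj G) \<and> length P = diam G + 1 \<and> vdist G (P ! 0) (P ! diam G) = diam G"

definition neighbors :: "'a pair_pre_digraph \<Rightarrow> 'a \<Rightarrow> 'a set" where
  "neighbors G u = {v. (u, v) \<in> parcs G}"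

text \<open>In a symmetric digraph without parallel arcs the out-degree is the undirected degree.\<close>

abbreviation deg :: "'a pair_pre_digraph \<Rightarrow> 'a \<Rightarrow> nat" where
  "deg G u \<equiv> out_degree (with_proj G) u"

definition nbr_deg_prod :: "'a pair_pre_digraph \<Rightarrow> 'a \<Rightarrow> nat" where
  "nbr_deg_prod G u = (\<Prod>v\<in>neighbors G u. deg G v)"

definition xi_ac :: "'a pair_pre_digraph \<Rightarrow> real" where
  "xi_ac G = (\<Sum>u\<in>pverts G. real (nbr_deg_prod G u) / real (ecc G u))"

definition pendant_neighbors :: "'a pair_pre_digraph \<Rightarrow> 'a \<Rightarrow> 'a set" where
  "pendant_neighbors G u = {w \<in> neighbors G u. deg G w = 1}"

definition edges_between :: "'a \<Rightarrow> 'a set \<Rightarrow> ('a \<times> 'a) set" where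
  "edges_between a W = {a} \<times> W \<union> W \<times> {a}"

definition move_edges :: "'a pair_pre_digraph \<Rightarrow> 'a \<Rightarrow> 'a \<Rightarrow> 'a set \<Rightarrow> 'a pair_pre_digraph" where
  "move_edges G a b W = G\<lparr>parcs := (parcs G - edges_between a W) \<union> edges_between b W\<rparr>"

end

theory Submission
  imports Defs
begin

text \<open>
  In a tree every vertex has at most one neighbor that is not farther away from a given target.
  Hence on a diametric path \<open>v\<^sub>0 \<dots> v\<^sub>D\<close> all neighbors of \<open>v\<^sub>1\<close> but \<open>v\<^sub>2\<close> are leaves, and
  \<open>\<epsilon>(v\<^sub>D\<^sub>-\<^sub>2) \<le> D - 2 \<le> \<epsilon>(v\<^sub>2)\<close>. Moving the \<open>k\<close> leaves from \<open>v\<^sub>1\<close> to \<open>v\<^sub>D\<^sub>-\<^sub>1\<close> increases no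
  eccentricity, because at the new place they are twins of \<open>v\<^sub>D\<close> (and pairwise at distance 2).
  The product \<open>M\<close> drops only at \<open>v\<^sub>2\<close>, by \<open>k M(v\<^sub>2) / deg v\<^sub>1\<close>, while it grows by
  \<open>k M(v\<^sub>D\<^sub>-\<^sub>2) / deg v\<^sub>D\<^sub>-\<^sub>1\<close> at \<open>v\<^sub>D\<^sub>-\<^sub>2\<close>; so the hypothesis makes up for the loss, and the moved
  leaves contribute a strict gain.
\<close>

section \<open>Distances as exponents of relation powers\<close>

context pair_wf_digraph
begin

text \<open>Relation powers make walks easy to compose and reverse, so all later distance arguments
  go through them. The membership of \<open>u\<close> accounts for the empty walk, which exists only
  at vertices.\<close>

lemma awalk_length_iff_relpow:
  "(\<exists>p. awalk u p v \<and> length p = k) \<longleftrightarrow> u \<in> pverts G \<and> (u, v) \<in> parcs G ^^ k"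
proof (induction k arbitrary: u)
  case 0
  then show ?case by (auto simp: awalk_Nil_iff)
next
  case (Suc k)
  have "(\<exists>p. awalk u p v \<and> length p = Suc k) \<longleftrightarrow>
      (\<exists>w. (u, w) \<in> parcs G \<and> (\<exists>p. awalk w p v \<and> length p = k))" (is "?L \<longleftrightarrow> ?R")
  proof
    assume ?L
    then obtain e p where "awalk u (e # p) v" "length p = k"
      by (auto simp: length_Suc_conv)
    then show ?R by (intro exI[of _ "snd e"]) (auto simp: awalk_Cons_iff)
  next
    assume ?R
    then obtain w p where "(u, w) \<in> parcs G" "awalk w p v" "length p = k" by blast
    then show ?L by (intro exI[of _ "(u, w) # p"]) (simp add: awalk_Cons_iff)
  qed
  also have "\<dots> \<longleftrightarrow> u \<in> pverts G \<and> (u, v) \<in> parcs G ^^ Suc k"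
    unfolding Suc by (meson in_arcsD1 in_arcsD2 relpow_Suc_I2 relpow_Suc_E2)
  finally show ?case .
qed

lemma vdist_eq_Least_relpow:
  assumes "u \<in> pverts G"
  shows "vdist G u v = (LEAST k. (u, v) \<in> parcs G ^^ k)"
  using assms awalk_length_iff_relpow by (simp add: vdist_def)

lemma vdist_le_relpow:
  assumes "u \<in> pverts G" "(u, v) \<in> parcs G ^^ k"
  shows "vdist G u v \<le> k"
  using assms by (simp add: vdist_eq_Least_relpow Least_le)

lemma relpow_vdist:
  assumes "u \<in> pverts G" "(u, v) \<in> parcs G ^^ k"
  shows "(u, v) \<in> parcs G ^^ vdist G u v"
  unfolding vdist_eq_Least_relpow[OF assms(1)] using assms(2) by (rule LeastI)

lemma vdist_pos:
  assumes "u \<in> pverts G" "(u, v) \<in> parcs G ^^ k" "u \<noteq> v"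
  shows "vdist G u v > 0"
  using relpow_vdist[OF assms(1,2)] assms(3) by (cases "vdist G u v") auto

end

section \<open>Degree, eccentricity and diameter\<close>

lemma deg_eq_card_neighbors: "deg G u = card (neighbors G u)"
proof -
  have "out_arcs (with_proj G) u = Pair u ` neighbors G u"
    by (auto simp: out_arcs_def neighbors_def)
  then show ?thesis
    by (simp add: out_degree_def card_image inj_on_def)
qed

lemma ecc_le:
  assumes "finite (pverts G)" "u \<in> pverts G" "\<And>v. v \<in> pverts G \<Longrightarrow> vdist G u v \<le> k"
  shows "ecc G u \<le> k"
  unfolding ecc_def using assms by (intro Max.boundedI) auto

lemma vdist_le_ecc:
  assumes "finite (pverts G)" "v \<in> pverts G"
  shows "vdist G u v \<le> ecc G u"
  unfolding ecc_def using assms by (intro Max_ge) auto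

lemma vdist_le_diam:
  assumes "finite (pverts G)" "u \<in> pverts G" "v \<in> pverts G"
  shows "vdist G u v \<le> diam G"
proof -
  have "finite {vdist G u v | u v. u \<in> pverts G \<and> v \<in> pverts G}"
    using assms(1) by (intro finite_image_set2) auto
  then show ?thesis
    unfolding diam_def using assms by (intro Max_ge) auto
qed

section \<open>Distances in a tree\<close>

locale undirected_tree_graph =
  fixes G :: "'a pair_pre_digraph"
  assumes undirected_tree: "undirected_tree G"
begin

sublocale pair_graph G
  using undirected_tree by (simp add: undirected_tree_def)

lemma no_undirected_cycle:
  assumes "cycle p"
  shows "length p < 3"
  using undirected_tree assms by (force simp: undirected_tree_def)

lemma neighbors_sym: "v \<in> neighbors G u \<longleftrightarrow> u \<in> neighbors G v"
  using arcs_symmetric by (auto simp: neighbors_def)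

lemma neighbors_in_verts: "v \<in> neighbors G u \<Longrightarrow> u \<in> pverts G" "v \<in> neighbors G u \<Longrightarrow> v \<in> pverts G"
  by (auto simp: neighbors_def dest: in_arcsD1 in_arcsD2)

lemma neighbors_irrefl: "u \<notin> neighbors G u"
  using pair_no_loops[of "(u, u)"] by (auto simp: neighbors_def)

lemma finite_neighbors: "finite (neighbors G u)"
  by (rule finite_subset[OF _ pair_finite_verts]) (auto dest: neighbors_in_verts)

text \<open>Connectedness is strong connectedness of the symmetric closure, and a symmetric arc
  relation is its own closure.\<close>

lemma connected_relpow:
  assumes "u \<in> pverts G" "v \<in> pverts G"
  shows "\<exists>k. (u, v) \<in> parcs G ^^ k"
proof -
  have "parcs (mk_symmetric G) = parcs G"
    using arcs_symmetric by (auto simp: parcs_mk_symmetric)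
  moreover have "strongly_connected (mk_symmetric G)"
    using undirected_tree by (simp add: undirected_tree_def connected_def)
  ultimately have "(u, v) \<in> rtrancl_on (pverts G) (parcs G)"
    using assms by (auto simp: strongly_connected_def reachable_def)
  then have "(u, v) \<in> (parcs G)\<^sup>*"
    by (rule rtrancl_on_rtranclI)
  then show ?thesis
    by (simp add: rtrancl_power)
qed

lemma relpow_vdist_verts:
  assumes "u \<in> pverts G" "v \<in> pverts G"
  shows "(u, v) \<in> parcs G ^^ vdist G u v"
  using connected_relpow[OF assms] relpow_vdist[OF assms(1)] by blast

lemma vdist_self: "u \<in> pverts G \<Longrightarrow> vdist G u u = 0"
  using vdist_le_relpow[of u u 0] by simp

lemma vdist_eq_0_iff:
  assumes "u \<in> pverts G" "v \<in> pverts G"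
  shows "vdist G u v = 0 \<longleftrightarrow> u = v"
  using relpow_vdist_verts[OF assms] vdist_self[OF assms(1)] by auto

lemma vdist_triangle:
  assumes "u \<in> pverts G" "v \<in> pverts G" "w \<in> pverts G"
  shows "vdist G u w \<le> vdist G u v + vdist G v w"
proof (rule vdist_le_relpow[OF assms(1)])
  show "(u, w) \<in> parcs G ^^ (vdist G u v + vdist G v w)"
    using relpow_vdist_verts[OF assms(1,2)] relpow_vdist_verts[OF assms(2,3)]
    by (auto simp: relpow_add)
qed

lemma relpow_sym: "(u, v) \<in> parcs G ^^ k \<Longrightarrow> (v, u) \<in> parcs G ^^ k"
proof (induction k arbitrary: v)
  case (Suc k)
  then obtain w where "(u, w) \<in> parcs G ^^ k" "(w, v) \<in> parcs G" by auto
  then show ?case using Suc.IH arcs_symmetric by (meson relpow_Suc_I2)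
qed auto

lemma vdist_sym:
  assumes "u \<in> pverts G" "v \<in> pverts G"
  shows "vdist G u v = vdist G v u"
  using relpow_vdist_verts[OF assms] relpow_vdist_verts[OF assms(2,1)] assms
  by (meson antisym relpow_sym vdist_le_relpow)

lemma vdist_neighbor:
  assumes "v \<in> neighbors G u" "x \<in> pverts G"
  shows "vdist G u x \<le> Suc (vdist G v x)"
proof (rule vdist_le_relpow)
  have "(v, x) \<in> parcs G ^^ vdist G v x"
    using assms neighbors_in_verts relpow_vdist_verts by blast
  then show "(u, x) \<in> parcs G ^^ Suc (vdist G v x)"
    using assms(1) relpow_Suc_I2[of u v] by (simp add: neighbors_def)
qed (rule neighbors_in_verts(1)[OF assms(1)])

text \<open>Take the second vertex of a shortest walk from \<open>u\<close> to
  \<open>x\<close>.\<close>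

lemma closer_neighbor:
  assumes "u \<in> pverts G" "x \<in> pverts G" "u \<noteq> x"
  obtains v where "v \<in> neighbors G u" "vdist G u x = Suc (vdist G v x)"
proof -
  have "vdist G u x \<noteq> 0"
    using vdist_eq_0_iff assms by blast
  then obtain k where k: "vdist G u x = Suc k"
    using not0_implies_Suc by blast
  then obtain v where v: "(u, v) \<in> parcs G" "(v, x) \<in> parcs G ^^ k"
    using relpow_vdist_verts[OF assms(1,2)] by (metis relpow_Suc_E2)
  have "v \<in> neighbors G u"
    using v by (simp add: neighbors_def)
  moreover have "vdist G v x \<le> k"
    using v vdist_le_relpow in_arcsD2 by blast
  moreover have "vdist G u x \<le> Suc (vdist G v x)"
    using \<open>v \<in> neighbors G u\<close> assms(2) by (rule vdist_neighbor)
  ultimately show ?thesis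
    using k that by force
qed

section \<open>Uniqueness of the neighbor towards a target\<close>

lemma apath_avoiding:
  assumes "(u, v) \<in> (parcs G \<inter> {(a, b). a \<noteq> c \<and> b \<noteq> c})\<^sup>*" "u \<in> pverts G" "u \<noteq> c"
  obtains p where "apath u p v" "c \<notin> set (pawalk_verts u p)"
proof -
  \<comment> \<open>The induction tracks only the heads of the arcs; the initial vertex is covered
    by \<open>u \<noteq> c\<close>.\<close>
  have "\<exists>p. awalk u p v \<and> c \<notin> snd ` set p"
    using assms(1,2)
  proof (induction rule: converse_rtrancl_induct)
    case base
    then show ?case by (intro exI[of _ "[]"]) (simp add: awalk_Nil_iff)
  next
    case (step y z)
    then obtain p where "awalk z p v" "c \<notin> snd ` set p"
      using in_arcsD2 by blast
    then show ?case
      using step.hyps(1) by (intro exI[of _ "(y, z) # p"]) (auto simp: awalk_Cons_iff)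
  qed
  then obtain p where p: "awalk u p v" "c \<notin> snd ` set p" by blast
  let ?q = "awalk_to_apath p"
  have q: "apath u ?q v"
    using p by (simp add: apath_awalk_to_apath)
  then have "pcas u ?q v"
    by (simp add: apath_def awalk_def)
  \<comment> \<open>The vertices of a walk are its start and the heads of its arcs. Shortening a
    walk to a path only discards arcs, so \<open>c\<close> stays avoided.\<close>
  then have "pawalk_verts u ?q = (if ?q = [] then [u] else fst (hd ?q) # map snd ?q)"
    and "?q \<noteq> [] \<Longrightarrow> fst (hd ?q) = u"
    using awalk_verts_conv'[of u ?q v] cas_simp[of ?q u v] by simp_all
  moreover have "c \<notin> snd ` set ?q"
    using p(2) awalk_to_apath_subset[OF p(1)] by blast
  ultimately have "c \<notin> set (pawalk_verts u ?q)"
    using assms(3) by auto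
  with q that show ?thesis by blast
qed

text \<open>Shortest walks from two such neighbors to \<open>x\<close> avoid \<open>c\<close>, so together with \<open>c\<close> they
  would contain a cycle.\<close>

lemma closer_neighbor_unique:
  assumes "p \<in> neighbors G c" "q \<in> neighbors G c" "x \<in> pverts G"
    and "vdist G p x \<le> vdist G c x" "vdist G q x \<le> vdist G c x"
  shows "p = q"
proof (rule ccontr)
  assume "p \<noteq> q"
  define R where "R = parcs G \<inter> {(a, b). a \<noteq> c \<and> b \<noteq> c}"
  have to_x: "(u, x) \<in> R\<^sup>*" if "vdist G u x \<le> vdist G c x" "u \<noteq> c" "u \<in> pverts G" for u
    using that
  proof (induction "vdist G u x" arbitrary: u)
    case 0
    then show ?case using vdist_eq_0_iff assms(3) by auto
  next
    case (Suc k)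
    then have "u \<noteq> x"
      using vdist_self assms(3) by auto
    then obtain v where v: "v \<in> neighbors G u" "vdist G u x = Suc (vdist G v x)"
      using closer_neighbor Suc.prems assms(3) by blast
    \<comment> \<open>If \<open>v\<close> were \<open>c\<close>, then \<open>c\<close> would be
      nearer to \<open>x\<close> than \<open>u\<close>, against the assumed bound.\<close>
    have "v \<noteq> c"
      using v Suc.prems by auto
    then have "(v, x) \<in> R\<^sup>*"
      using v Suc neighbors_in_verts by (metis Suc_leD old.nat.inject)
    moreover have "(u, v) \<in> R"
      using v Suc.prems \<open>v \<noteq> c\<close> by (simp add: R_def neighbors_def)
    ultimately show ?case by (rule converse_rtrancl_into_rtrancl[rotated])
  qed
  have ne: "p \<noteq> c" "q \<noteq> c"
    using assms neighbors_irrefl by auto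
  have V: "p \<in> pverts G" "q \<in> pverts G" "c \<in> pverts G"
    using assms neighbors_in_verts by blast+
  have "sym R"
    using arcs_symmetric by (auto simp: R_def sym_def)
  then have "(x, q) \<in> R\<^sup>*"
    using to_x[of q] assms ne V by (meson sym_rtrancl symD)
  then have "(p, q) \<in> R\<^sup>*"
    using to_x[of p] assms ne V by (meson rtrancl_trans)
  then obtain \<pi> where \<pi>: "apath p \<pi> q" "c \<notin> set (pawalk_verts p \<pi>)"
    using apath_avoiding V ne unfolding R_def by blast
  have "\<pi> \<noteq> []"
    using \<pi> \<open>p \<noteq> q\<close> by (auto simp: apath_Nil_iff)
  have arcs: "(c, p) \<in> parcs G" "(q, c) \<in> parcs G"
    using assms arcs_symmetric by (auto simp: neighbors_def)
  have walk: "awalk p \<pi> q" and dist: "distinct (pawalk_verts p \<pi>)"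
    using \<pi> by (auto simp: apath_def)
  have "awalk p (\<pi> @ [(q, c)]) c"
    using walk arcs V by (intro awalk_appendI[of _ _ q]) (auto simp: awalk_simps)
  moreover have "pawalk_verts p (\<pi> @ [(q, c)]) = pawalk_verts p \<pi> @ [c]"
    using awalk_verts_append[OF calculation] by simp
  ultimately have "cycle ((c, p) # \<pi> @ [(q, c)])"
    unfolding cycle_def using arcs V dist \<pi>
    by (auto simp: awalk_Cons_iff intro!: exI[of _ c])
  \<comment> \<open>Since \<open>p \<noteq> q\<close>, the path \<open>\<pi>\<close> has an arc, so
    the cycle through \<open>c\<close> has at least three.\<close>
  from no_undirected_cycle[OF this] show False
    using \<open>\<pi> \<noteq> []\<close> by (simp add: numeral_3_eq_3 Suc_lessI)
qed

text \<open>The place of the only neighbor not farther from \<open>x\<close> is taken by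
  \<open>p\<close>, and one step changes the distance by at most 1.\<close>

lemma farther_neighbor:
  assumes "p \<in> neighbors G c" "q \<in> neighbors G c" "p \<noteq> q" "x \<in> pverts G"
    and "vdist G p x \<le> vdist G c x"
  shows "vdist G q x = Suc (vdist G c x)"
proof -
  have "\<not> vdist G q x \<le> vdist G c x"
    using closer_neighbor_unique assms by blast
  moreover have "vdist G q x \<le> Suc (vdist G c x)"
    using vdist_neighbor[of c q x] assms(2,4) neighbors_sym[of c q] by simp
  ultimately show ?thesis by simp
qed

lemma vdist_via_leaf:
  assumes "neighbors G w = {c}" "x \<in> pverts G" "x \<noteq> w"
  shows "vdist G w x = Suc (vdist G c x)"
  using closer_neighbor[of w x] assms neighbors_in_verts(1)[of c w] by auto

text \<open>As \<open>z\<close> is the neighbor of \<open>c\<close> towards \<open>x\<close>, the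
  vertex \<open>w\<close> lies one step beyond \<open>c\<close>, at distance \<open>diam G\<close>.
  A further neighbor of \<open>w\<close> would exceed the diameter. This serves both ends of the
  diametric path.\<close>

lemma neighbors_at_eccentricity:
  assumes "z \<in> neighbors G c" "x \<in> pverts G" "Suc (vdist G z x) = vdist G c x"
    and "Suc (vdist G c x) = diam G"
    and "w \<in> neighbors G c" "w \<noteq> z"
  shows "neighbors G w = {c}" "vdist G w x = diam G"
proof -
  show dw: "vdist G w x = diam G"
    using farther_neighbor[of z c w x] assms by simp
  have "y = c" if "y \<in> neighbors G w" for y
  proof (rule ccontr)
    assume "y \<noteq> c"
    have "vdist G y x = Suc (vdist G w x)"
      using farther_neighbor[of c w y x] that assms(2,4,5) \<open>y \<noteq> c\<close> neighbors_sym[of c w] dw by simp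
    moreover have "vdist G y x \<le> diam G"
      using vdist_le_diam[OF pair_finite_verts neighbors_in_verts(2)[OF that] assms(2)] .
    ultimately show False using dw by simp
  qed
  moreover have "c \<in> neighbors G w"
    using assms(5) neighbors_sym[of c w] by simp
  ultimately show "neighbors G w = {c}" by blast
qed

end

section \<open>Distances along a diametric path\<close>

lemma nth_in_vwalk_arcs: "Suc i < length p \<Longrightarrow> (p ! i, p ! Suc i) \<in> set (vwalk_arcs p)"
proof (induction p arbitrary: i rule: vwalk_arcs.induct)
  case (3 x y xs)
  then show ?case by (cases i) auto
qed auto

locale long_diametric_path = undirected_tree_graph G
  for G :: "'a pair_pre_digraph" +
  fixes P :: "'a list" and D :: nat
  assumes D_eq: "D = diam G" and D_ge: "5 \<le> D" and diametric: "diametric_path G P"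
begin

lemma path_in_verts: "i \<le> D \<Longrightarrow> P ! i \<in> pverts G"
  using diametric by (auto simp: diametric_path_def vpath_def vwalk_def D_eq)

lemma path_neighbors:
  assumes "i < D"
  shows "P ! Suc i \<in> neighbors G (P ! i)" "P ! i \<in> neighbors G (P ! Suc i)"
proof -
  have "(P ! i, P ! Suc i) \<in> set (vwalk_arcs P)"
    using assms diametric by (intro nth_in_vwalk_arcs) (simp add: diametric_path_def D_eq)
  then show "P ! Suc i \<in> neighbors G (P ! i)"
    using diametric by (auto simp: diametric_path_def vpath_def vwalk_def neighbors_def)
  then show "P ! i \<in> neighbors G (P ! Suc i)"
    using neighbors_sym[of "P ! i"] by simp
qed

lemma vdist_path_le: "i + k \<le> D \<Longrightarrow> vdist G (P ! i) (P ! (i + k)) \<le> k"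
proof (induction k arbitrary: i)
  case 0
  then show ?case by (simp add: vdist_self path_in_verts)
next
  case (Suc k)
  have "vdist G (P ! i) (P ! (i + Suc k)) \<le> Suc (vdist G (P ! Suc i) (P ! (i + Suc k)))"
    using Suc.prems by (intro vdist_neighbor path_neighbors path_in_verts) auto
  with Suc.IH[of "Suc i"] Suc.prems show ?case by simp
qed

text \<open>The upper bounds for the three segments cut by \<open>i\<close> and \<open>j\<close> add
  up to \<open>D\<close>, the distance of the ends, so each is attained.\<close>

lemma vdist_path:
  assumes "i \<le> j" "j \<le> D"
  shows "vdist G (P ! i) (P ! j) = j - i" "vdist G (P ! j) (P ! i) = j - i"
proof -
  have "vdist G (P ! 0) (P ! D) = D"
    using diametric by (simp add: diametric_path_def D_eq)
  moreover have "vdist G (P ! 0) (P ! D) \<le> vdist G (P ! 0) (P ! i) + vdist G (P ! i) (P ! D)"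
    using assms by (intro vdist_triangle path_in_verts) auto
  moreover have "vdist G (P ! i) (P ! D) \<le> vdist G (P ! i) (P ! j) + vdist G (P ! j) (P ! D)"
    using assms by (intro vdist_triangle path_in_verts) auto
  moreover have "vdist G (P ! 0) (P ! i) \<le> i" "vdist G (P ! i) (P ! j) \<le> j - i"
    "vdist G (P ! j) (P ! D) \<le> D - j"
    using vdist_path_le[of 0 i] vdist_path_le[of i "j - i"] vdist_path_le[of j "D - j"] assms by auto
  ultimately show "vdist G (P ! i) (P ! j) = j - i"
    using assms by linarith
  then show "vdist G (P ! j) (P ! i) = j - i"
    using vdist_sym[OF path_in_verts path_in_verts, of i j] assms by simp
qed

lemma path_eq_iff: "i \<le> D \<Longrightarrow> j \<le> D \<Longrightarrow> P ! i = P ! j \<longleftrightarrow> i = j"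
  using diametric by (simp add: diametric_path_def vpath_def D_eq nth_eq_iff_index_eq)

text \<open>If the next path vertex is nearer to \<open>x\<close>, the preceding one must be
  farther; this propagates back to \<open>P ! 0\<close>.\<close>

lemma vdist_moving_away_left:
  assumes "x \<in> pverts G" "Suc i \<le> D"
    and "vdist G (P ! i) x = Suc (vdist G (P ! Suc i) x)"
  shows "vdist G (P ! 0) x = i + vdist G (P ! i) x"
  using assms(2,3)
proof (induction i)
  case (Suc i)
  have "vdist G (P ! i) x = Suc (vdist G (P ! Suc i) x)"
    using Suc.prems assms(1) path_neighbors(1)[of "Suc i"] path_neighbors(2)[of i]
      path_eq_iff[of "Suc (Suc i)" i]
    by (intro farther_neighbor[of "P ! Suc (Suc i)"]) auto
  with Suc show ?case by simp
qed simp

text \<open>Either the path leads away from \<open>x\<close> after \<open>P ! (D - 2)\<close>, so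
  that \<open>P ! D\<close> is two steps farther from \<open>x\<close>; or \<open>x\<close> lies
  beyond \<open>P ! (D - 2)\<close> as seen from \<open>P ! 0\<close>, hence at most 2 away from it.
  The diameter bounds both cases.\<close>

lemma ecc_third_last_le: "ecc G (P ! (D - 2)) \<le> D - 2"
proof (rule ecc_le[OF pair_finite_verts path_in_verts])
  fix x assume x: "x \<in> pverts G"
  define i where "i = D - 3"
  have i: "D = i + 3" "D - 2 = Suc i" "2 \<le> i"
    using D_ge by (auto simp: i_def)
  have far: "vdist G (P ! 0) x \<le> D" "vdist G (P ! D) x \<le> D"
    using vdist_le_diam[OF pair_finite_verts] x path_in_verts D_eq by auto
  have nb: "P ! i \<in> neighbors G (P ! Suc i)" "P ! Suc (Suc i) \<in> neighbors G (P ! Suc i)"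
    "P ! Suc i \<in> neighbors G (P ! Suc (Suc i))" "P ! Suc (Suc (Suc i)) \<in> neighbors G (P ! Suc (Suc i))"
    using i by (auto intro: path_neighbors)
  show "vdist G (P ! (D - 2)) x \<le> D - 2"
  proof (cases "vdist G (P ! i) x \<le> vdist G (P ! Suc i) x")
    case True
    have "vdist G (P ! Suc (Suc i)) x = Suc (vdist G (P ! Suc i) x)"
      using farther_neighbor[OF nb(1,2) _ x True] path_eq_iff i by simp
    moreover from this have "vdist G (P ! Suc (Suc (Suc i))) x = Suc (vdist G (P ! Suc (Suc i)) x)"
      using farther_neighbor[OF nb(3,4) _ x] path_eq_iff i by simp
    ultimately show ?thesis
      using far i by (simp add: numeral_3_eq_3)
  next
    case False
    then have "vdist G (P ! i) x = Suc (vdist G (P ! Suc i) x)"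
      using vdist_neighbor[OF nb(1)[unfolded neighbors_sym[of "P ! i"]] x] by simp
    then have "vdist G (P ! 0) x = i + Suc (vdist G (P ! Suc i) x)"
      using vdist_moving_away_left[OF x, of i] i by simp
    then show ?thesis
      using far i by simp
  qed
qed simp

section \<open>The leaves at both ends of the path\<close>

definition end_leaves :: "'a set" where
  "end_leaves = neighbors G (P ! 1) - {P ! 2}"

lemma end_leaves:
  assumes "w \<in> end_leaves"
  shows "neighbors G w = {P ! 1}" "vdist G w (P ! D) = D"
proof -
  have "P ! 2 \<in> neighbors G (P ! 1)"
    using path_neighbors(1)[of 1] D_ge by (simp add: numeral_2_eq_2)
  moreover have "Suc (vdist G (P ! 2) (P ! D)) = vdist G (P ! 1) (P ! D)"
    "Suc (vdist G (P ! 1) (P ! D)) = D"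
    using D_ge by (simp_all add: vdist_path)
  ultimately show "neighbors G w = {P ! 1}" "vdist G w (P ! D) = D"
    using neighbors_at_eccentricity[of "P ! 2" "P ! 1" "P ! D" w] assms path_in_verts[of D] D_eq
    by (simp_all add: end_leaves_def)
qed

lemma second_last_neighbors:
  "P ! (D - 2) \<in> neighbors G (P ! (D - 1))" "P ! D \<in> neighbors G (P ! (D - 1))"
  using path_neighbors(2)[of "D - 2"] path_neighbors(1)[of "D - 1"] D_ge
  by (simp_all add: Suc_diff_Suc numeral_2_eq_2)

text \<open>The argument for the end leaves, mirrored. It makes \<open>P ! D\<close> the model for
  the leaves moved to \<open>P ! (D - 1)\<close>.\<close>

lemma neighbors_last: "neighbors G (P ! D) = {P ! (D - 1)}"
proof (rule neighbors_at_eccentricity(1)[OF second_last_neighbors(1) _ _ _ second_last_neighbors(2)])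
  show "P ! 0 \<in> pverts G" "P ! D \<noteq> P ! (D - 2)"
    using path_in_verts path_eq_iff D_ge by auto
  show "Suc (vdist G (P ! (D - 2)) (P ! 0)) = vdist G (P ! (D - 1)) (P ! 0)"
    "Suc (vdist G (P ! (D - 1)) (P ! 0)) = diam G"
    using D_ge by (simp_all add: vdist_path flip: D_eq)
qed

lemma first_in_end_leaves: "P ! 0 \<in> end_leaves"
  using path_neighbors(2)[of 0] path_eq_iff[of 0 2] D_ge by (simp add: end_leaves_def)

text \<open>End leaves have distance \<open>D\<close> from \<open>P ! D\<close>, which on the path
  only \<open>P ! 0\<close> has.\<close>

lemma path_not_in_end_leaves: "0 < i \<Longrightarrow> i \<le> D \<Longrightarrow> P ! i \<notin> end_leaves"
  using end_leaves(2)[of "P ! i"] vdist_path(1)[of i D] D_ge by fastforce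

text \<open>The vertex \<open>P ! 2\<close> is no leaf, having the neighbors \<open>P ! 1\<close>
  and \<open>P ! 3\<close>. This links the degree condition of the theorem to
  \<open>end_leaves\<close>, which is defined without degrees.\<close>

lemma pendant_neighbors_second: "pendant_neighbors G (P ! 1) = end_leaves"
proof -
  have "P ! 1 \<in> neighbors G (P ! 2)" "P ! 3 \<in> neighbors G (P ! 2)"
    using path_neighbors(2)[of 1] path_neighbors(1)[of 2] D_ge
    by (simp_all add: numeral_2_eq_2 numeral_3_eq_3)
  moreover have "P ! 1 \<noteq> P ! 3"
    using path_eq_iff D_ge by simp
  ultimately have "deg G (P ! 2) \<noteq> 1"
    unfolding deg_eq_card_neighbors by (metis card_1_singletonE singletonD)
  moreover have "deg G w = 1" if "w \<in> end_leaves" for w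
    using end_leaves(1)[OF that] by (simp add: deg_eq_card_neighbors)
  ultimately show ?thesis
    unfolding pendant_neighbors_def end_leaves_def by blast
qed

section \<open>The modified graph and its neighborhoods\<close>

definition G' :: "'a pair_pre_digraph" where
  "G' = move_edges G (P ! 1) (P ! (D - 1)) end_leaves"

lemma parcs_moved: "parcs G' = (parcs G - edges_between (P ! 1) end_leaves) \<union> edges_between (P ! (D - 1)) end_leaves"
  by (simp add: G'_def move_edges_def)

lemma pverts_moved [simp]: "pverts G' = pverts G"
  by (simp add: G'_def move_edges_def)

lemma
  shows neighbors_moved_leaf: "w \<in> end_leaves \<Longrightarrow> neighbors G' w = {P ! (D - 1)}"
    and neighbors_moved_second: "neighbors G' (P ! 1) = {P ! 2}"
    and neighbors_moved_second_last: "neighbors G' (P ! (D - 1)) = neighbors G (P ! (D - 1)) \<union> end_leaves"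
    and neighbors_moved_other:
      "u \<notin> end_leaves \<Longrightarrow> u \<noteq> P ! 1 \<Longrightarrow> u \<noteq> P ! (D - 1) \<Longrightarrow> neighbors G' u = neighbors G u"
proof -
  have nb: "neighbors G' u = {v \<in> neighbors G u. \<not> (u = P ! 1 \<and> v \<in> end_leaves) \<and> \<not> (u \<in> end_leaves \<and> v = P ! 1)}
      \<union> {v. u = P ! (D - 1) \<and> v \<in> end_leaves \<or> u \<in> end_leaves \<and> v = P ! (D - 1)}" for u
    by (auto simp: neighbors_def parcs_moved edges_between_def)
  \<comment> \<open>The old hub, the new hub and the moved leaves are kept apart, so each vertex
    falls under just one clause of \<open>nb\<close>.\<close>
  have ne: "P ! 1 \<notin> end_leaves" "P ! (D - 1) \<notin> end_leaves" "P ! 1 \<noteq> P ! (D - 1)"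
    using path_not_in_end_leaves[of 1] path_not_in_end_leaves[of "D - 1"] path_eq_iff[of 1 "D - 1"] D_ge
    by auto
  have "P ! 2 \<in> neighbors G (P ! 1)"
    using path_neighbors(1)[of 1] D_ge by (simp add: numeral_2_eq_2)
  then show "neighbors G' (P ! 1) = {P ! 2}"
    unfolding nb using ne by (auto simp: end_leaves_def)
  show "neighbors G' w = {P ! (D - 1)}" if "w \<in> end_leaves"
    unfolding nb end_leaves(1)[OF that] using that ne by auto
  show "neighbors G' (P ! (D - 1)) = neighbors G (P ! (D - 1)) \<union> end_leaves"
    unfolding nb using ne by auto
  show "neighbors G' u = neighbors G u" if "u \<notin> end_leaves" "u \<noteq> P ! 1" "u \<noteq> P ! (D - 1)"
    unfolding nb using that by auto
qed

lemma end_leaves_in_verts: "w \<in> end_leaves \<Longrightarrow> w \<in> pverts G"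
  by (auto simp: end_leaves_def dest: neighbors_in_verts(2))

section \<open>Walks and eccentricities in the modified graph\<close>

sublocale moved: pair_wf_digraph G'
  using path_in_verts[of "D - 1"] end_leaves_in_verts
  by unfold_locales (auto simp: parcs_moved edges_between_def dest: in_arcsD1 in_arcsD2)

text \<open>Every removed arc touches an end leaf, and a shortest walk between other vertices visits
  none: it would have to return to the vertex it came from.\<close>

lemma moved_relpow_vdist:
  assumes "u \<in> pverts G" "x \<in> pverts G" "u \<notin> end_leaves" "x \<notin> end_leaves"
  shows "(u, x) \<in> parcs G' ^^ vdist G u x"
  using assms(1,3)
proof (induction "vdist G u x" arbitrary: u)
  case 0
  then show ?case using vdist_eq_0_iff[of u x] vdist_self[of x] assms(2) by simp
next
  case (Suc k)
  then have "u \<noteq> x"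
    using vdist_self[of x] assms(2) by auto
  then obtain v where v: "v \<in> neighbors G u" "vdist G u x = Suc (vdist G v x)"
    using closer_neighbor[of u x] Suc.prems assms(2) by metis
  have "v \<notin> end_leaves"
  proof
    assume "v \<in> end_leaves"
    then have "neighbors G v = {u}" "v \<noteq> x"
      using v(1) neighbors_sym[of v u] end_leaves(1)[of v] assms(4) by auto
    then show False
      using vdist_via_leaf[of v u x] assms(2) v(2) by simp
  qed
  then have "(v, x) \<in> parcs G' ^^ k"
    using Suc v neighbors_in_verts(2)[OF v(1)] by simp
  moreover have "(u, v) \<in> parcs G'"
    using v(1) \<open>v \<notin> end_leaves\<close> Suc.prems
    by (auto simp: neighbors_def parcs_moved edges_between_def)
  ultimately show ?case
    using Suc.hyps(2) by (metis relpow_Suc_I2)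
qed

text \<open>In \<open>G'\<close> an end leaf hangs at \<open>P ! (D - 1)\<close> like
  \<open>P ! D\<close>, so distances from \<open>P ! D\<close> in \<open>G\<close> bound its walks.
  Pairs without end leaves keep their shortest walks.\<close>

lemma moved_walk:
  assumes "u \<in> pverts G" "x \<in> pverts G"
  obtains k where "k \<le> ecc G u" "(u, x) \<in> parcs G' ^^ k"
proof -
  let ?b = "P ! (D - 1)"
  have b: "?b \<in> pverts G" "?b \<notin> end_leaves"
    using path_in_verts[of "D - 1"] path_not_in_end_leaves[of "D - 1"] D_ge by auto
  have arcs: "(w, ?b) \<in> parcs G'" "(?b, w) \<in> parcs G'" if "w \<in> end_leaves" for w
    using that by (auto simp: parcs_moved edges_between_def)
  have last: "Suc (vdist G ?b y) = vdist G (P ! D) y" if "y \<in> pverts G" "y \<noteq> P ! D" for y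
    using vdist_via_leaf[OF neighbors_last that] by simp
  have last_b: "vdist G (P ! D) ?b = 1" "vdist G ?b (P ! D) = 1"
    using vdist_path[of "D - 1" D] D_ge by auto
  have ecc_ge: "vdist G u y \<le> ecc G u" if "y \<in> pverts G" for y
    using vdist_le_ecc[OF pair_finite_verts that] .
  consider "u = x" | "u \<noteq> x" "u \<notin> end_leaves" "x \<notin> end_leaves"
    | "u \<noteq> x" "u \<notin> end_leaves" "x \<in> end_leaves" | "u \<noteq> x" "u \<in> end_leaves" "x \<notin> end_leaves"
    | "u \<noteq> x" "u \<in> end_leaves" "x \<in> end_leaves"
    by blast
  then show ?thesis
  proof cases
    case 1
    then show ?thesis using that[of 0] by simp
  next
    case 2
    then show ?thesis
      using that[OF ecc_ge[OF assms(2)]] moved_relpow_vdist[OF assms] by simp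
  next
    case 3
    have "(u, x) \<in> parcs G' ^^ Suc (vdist G u ?b)"
      using moved_relpow_vdist[OF assms(1) b(1) 3(2) b(2)] arcs(2)[OF 3(3)] by (rule relpow_Suc_I)
    moreover have "Suc (vdist G u ?b) \<le> ecc G u"
    \<comment> \<open>For \<open>u = P ! D\<close> the walk has length 2, while \<open>P ! 0\<close>
      is at distance \<open>D\<close>. Otherwise its length is the distance from \<open>u\<close> to
      \<open>P ! D\<close>.\<close>
    proof (cases "u = P ! D")
      case True
      then show ?thesis
        using last_b ecc_ge[OF path_in_verts[of 0]] vdist_path(2)[of 0 D] D_ge by simp
    next
      case False
      then show ?thesis
        using last[OF assms(1)] ecc_ge[OF path_in_verts[of D]] vdist_sym[OF assms(1) b(1)]
          vdist_sym[OF assms(1) path_in_verts[of D]]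
        by simp
    qed
    ultimately show ?thesis
      using that by blast
  next
    case 4
    have "(u, x) \<in> parcs G' ^^ Suc (vdist G ?b x)"
      using arcs(1)[OF 4(2)] moved_relpow_vdist[OF b(1) assms(2) b(2) 4(3)] by (rule relpow_Suc_I2)
    moreover have "Suc (vdist G ?b x) \<le> D"
    \<comment> \<open>The length is 2 for \<open>x = P ! D\<close> and otherwise the distance from
      \<open>P ! D\<close> to \<open>x\<close>. The bound \<open>D\<close> is enough because
      \<open>u\<close> already had eccentricity at least \<open>D\<close> in
      \<open>G\<close>.\<close>
    proof (cases "x = P ! D")
      case False
      then show ?thesis
        using last[OF assms(2)] vdist_le_diam[OF pair_finite_verts path_in_verts[of D] assms(2)] D_eq
        by simp
    qed (use last_b D_ge in simp)
    moreover have "D \<le> ecc G u"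
      using ecc_ge[OF path_in_verts[of D]] end_leaves(2)[of u] 4 by simp
    ultimately show ?thesis
      using that[of "Suc (vdist G ?b x)"] by linarith
  next
    case 5
    have "(u, x) \<in> parcs G' ^^ 2"
      using arcs(1)[of u] arcs(2)[of x] 5 by (auto simp: numeral_2_eq_2)
    moreover have "D \<le> ecc G u"
      using ecc_ge[OF path_in_verts[of D]] end_leaves(2)[of u] 5 by simp
    ultimately show ?thesis
      using that[of 2] D_ge by linarith
  qed
qed

lemma ecc_moved_le:
  assumes "u \<in> pverts G"
  shows "ecc G' u \<le> ecc G u"
proof (rule ecc_le)
  fix x assume "x \<in> pverts G'"
  then obtain k where "k \<le> ecc G u" "(u, x) \<in> parcs G' ^^ k"
    using moved_walk[OF assms, of x] by auto
  then show "vdist G' u x \<le> ecc G u"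
    using moved.vdist_le_relpow[of u x k] assms by simp
qed (use assms pair_finite_verts in auto)

text \<open>Needed to compare fractions with these denominators. One of two path vertices differs
  from \<open>u\<close>, and a walk to it in \<open>G'\<close> makes the least length in
  \<open>vdist\<close> meaningful.\<close>

lemma ecc_moved_pos:
  assumes "u \<in> pverts G"
  shows "0 < ecc G' u"
proof -
  have "P ! 0 \<in> pverts G" "P ! 1 \<in> pverts G" "P ! 0 \<noteq> P ! 1"
    using path_in_verts[of 0] path_in_verts[of 1] path_eq_iff[of 0 1] D_ge by auto
  then obtain x where x: "x \<in> pverts G" "u \<noteq> x"
    by metis
  obtain k where "(u, x) \<in> parcs G' ^^ k"
    using moved_walk[OF assms x(1)] .
  then have "0 < vdist G' u x"
    using moved.vdist_pos[of u x k] assms x(2) by simp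
  also have "\<dots> \<le> ecc G' u"
    using vdist_le_ecc[of G' x u] x pair_finite_verts by simp
  finally show ?thesis .
qed

section \<open>Degrees and degree products before and after the move\<close>

declare One_nat_def [simp del]

lemma neighbors_second: "neighbors G (P ! 1) = insert (P ! 2) end_leaves"
  using path_neighbors(1)[of 1] D_ge by (auto simp: end_leaves_def Suc_1)

lemma finite_end_leaves: "finite end_leaves"
  by (simp add: end_leaves_def finite_neighbors)

lemma deg_second: "deg G (P ! 1) = Suc (card end_leaves)"
  unfolding deg_eq_card_neighbors neighbors_second
  by (rule card_insert_disjoint[OF finite_end_leaves]) (simp add: end_leaves_def)

lemma end_leaves_not_neighbors_second_last: "neighbors G (P ! (D - 1)) \<inter> end_leaves = {}"
proof -
  have "P ! (D - 1) \<noteq> P ! 1"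
    using path_eq_iff[of "D - 1" 1] D_ge by simp
  then have "P ! (D - 1) \<notin> neighbors G w" if "w \<in> end_leaves" for w
    using end_leaves(1)[OF that] by simp
  then show ?thesis
    using neighbors_sym[of _ "P ! (D - 1)"] by auto
qed

lemma deg_moved_second: "deg G' (P ! 1) = 1"
  by (simp add: deg_eq_card_neighbors neighbors_moved_second)

lemma deg_moved_second_last: "deg G' (P ! (D - 1)) = deg G (P ! (D - 1)) + card end_leaves"
  unfolding deg_eq_card_neighbors neighbors_moved_second_last
  using finite_neighbors finite_end_leaves end_leaves_not_neighbors_second_last
  by (rule card_Un_disjoint)

lemma deg_leaf: "w \<in> end_leaves \<Longrightarrow> deg G w = 1"
  by (simp add: deg_eq_card_neighbors end_leaves(1))

lemma deg_moved_leaf: "w \<in> end_leaves \<Longrightarrow> deg G' w = 1"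
  by (simp add: deg_eq_card_neighbors neighbors_moved_leaf)

text \<open>A moved leaf trades one edge for another; only the two hubs change degree.\<close>

lemma deg_moved_other:
  assumes "u \<noteq> P ! 1" "u \<noteq> P ! (D - 1)"
  shows "deg G' u = deg G u"
proof (cases "u \<in> end_leaves")
  case False
  then show ?thesis
    using assms by (simp add: deg_eq_card_neighbors neighbors_moved_other)
qed (simp add: deg_leaf deg_moved_leaf)

lemma deg_le_moved: "u \<noteq> P ! 1 \<Longrightarrow> deg G u \<le> deg G' u"
  using deg_moved_other[of u] deg_moved_second_last by (cases "u = P ! (D - 1)") auto

lemma deg_second_last_ge: "2 \<le> deg G (P ! (D - 1))"
proof -
  have "card {P ! (D - 2), P ! D} \<le> card (neighbors G (P ! (D - 1)))"
    using second_last_neighbors by (intro card_mono finite_neighbors) auto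
  moreover have "P ! (D - 2) \<noteq> P ! D"
    using path_eq_iff[of "D - 2" D] D_ge by simp
  ultimately show ?thesis
    by (simp add: deg_eq_card_neighbors)
qed

text \<open>Hence the drop of the degree of \<open>P ! 1\<close> affects the products only at
  \<open>P ! 2\<close> and at the end leaves.\<close>

lemma second_not_neighbor: "u \<noteq> P ! 2 \<Longrightarrow> u \<notin> end_leaves \<Longrightarrow> P ! 1 \<notin> neighbors G u"
  using neighbors_second neighbors_sym[of "P ! 1" u] by simp

text \<open>With \<open>k\<close> end leaves, the degree of the only neighbor is
  \<open>k + 1\<close> before the move and at least \<open>k + 2\<close> after it. The strictness of
  the theorem comes from here.\<close>

lemma nbr_deg_prod_moved_leaf:
  assumes "w \<in> end_leaves"
  shows "nbr_deg_prod G w < nbr_deg_prod G' w"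
  using assms deg_second_last_ge
  by (simp add: nbr_deg_prod_def end_leaves(1) neighbors_moved_leaf deg_second deg_moved_second_last)

text \<open>The end leaves gain, the hubs lose or acquire only factors 1, and no other vertex except
  \<open>P ! 2\<close> is adjacent to \<open>P ! 1\<close>.\<close>

lemma nbr_deg_prod_le_moved:
  assumes "u \<noteq> P ! 2"
  shows "nbr_deg_prod G u \<le> nbr_deg_prod G' u"
proof -
  have ne: "P ! 2 \<noteq> P ! 1" "P ! 2 \<noteq> P ! (D - 1)" "P ! 2 \<notin> end_leaves"
    "P ! (D - 1) \<notin> end_leaves"
    using D_ge by (simp_all add: path_eq_iff path_not_in_end_leaves)
  have mono: "prod (deg G) (neighbors G u) \<le> prod (deg G') (neighbors G u)" if "u \<notin> end_leaves"
  proof (rule prod_mono)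
    fix v assume "v \<in> neighbors G u"
    then have "v \<noteq> P ! 1"
      using second_not_neighbor[OF assms that] by blast
    then show "0 \<le> deg G v \<and> deg G v \<le> deg G' v"
      using deg_le_moved by simp
  qed
  consider "u \<in> end_leaves" | "u = P ! 1" | "u = P ! (D - 1)"
    | "u \<notin> end_leaves" "u \<noteq> P ! 1" "u \<noteq> P ! (D - 1)"
    by blast
  then show ?thesis
  proof cases
    case 1
    then show ?thesis using nbr_deg_prod_moved_leaf by (simp add: less_imp_le)
  next
    case 2
    have "prod (deg G) end_leaves = 1"
      by (intro prod.neutral ballI deg_leaf)
    then have "nbr_deg_prod G (P ! 1) = deg G (P ! 2)"
      unfolding nbr_deg_prod_def neighbors_second using ne(3) finite_end_leaves by simp
    also have "\<dots> = nbr_deg_prod G' (P ! 1)"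
      unfolding nbr_deg_prod_def neighbors_moved_second using deg_moved_other[OF ne(1,2)] by simp
    finally show ?thesis
      by (simp add: 2)
  next
    case 3
    have "nbr_deg_prod G' u = prod (deg G') (neighbors G u) * prod (deg G') end_leaves"
      unfolding 3 nbr_deg_prod_def neighbors_moved_second_last
      using finite_neighbors finite_end_leaves end_leaves_not_neighbors_second_last
      by (rule prod.union_disjoint)
    also have "prod (deg G') end_leaves = 1"
      by (intro prod.neutral ballI deg_moved_leaf)
    finally show ?thesis
      using mono ne(4) unfolding nbr_deg_prod_def[of G] 3 by simp
  next
    case 4
    then show ?thesis
      using mono unfolding nbr_deg_prod_def by (simp only: neighbors_moved_other simp_thms)
  qed
qed

text \<open>Here \<open>X\<close> is the quotient of \<open>M\<close> at \<open>P ! 2\<close> by the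
  degree of \<open>P ! 1\<close>, obtained as the product over the other neighbors.\<close>

lemma nbr_deg_prod_third:
  obtains X where "nbr_deg_prod G (P ! 2) = Suc (card end_leaves) * X" "nbr_deg_prod G' (P ! 2) = X"
proof -
  let ?N = "neighbors G (P ! 2) - {P ! 1}"
  have "P ! 1 \<in> neighbors G (P ! 2)"
    using path_neighbors(2)[of 1] D_ge by (simp add: Suc_1)
  then have split: "(\<Prod>v\<in>neighbors G (P ! 2). f v) = f (P ! 1) * prod f ?N" for f :: "'a \<Rightarrow> nat"
    by (simp add: finite_neighbors prod.remove)
  have nb: "neighbors G' (P ! 2) = neighbors G (P ! 2)"
    using D_ge by (intro neighbors_moved_other) (simp_all add: path_eq_iff path_not_in_end_leaves)
  \<comment> \<open>Adjacency would put \<open>P ! D\<close> within 2 of \<open>P ! 2\<close>, but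
    \<open>D \<ge> 5\<close> makes their distance \<open>D - 2\<close> at least 3.\<close>
  have "P ! (D - 1) \<notin> neighbors G (P ! 2)"
  proof
    assume "P ! (D - 1) \<in> neighbors G (P ! 2)"
    then have "vdist G (P ! 2) (P ! D) \<le> Suc (vdist G (P ! (D - 1)) (P ! D))"
      using path_in_verts[of D] by (intro vdist_neighbor) auto
    then show False
      using vdist_path(1)[of 2 D] vdist_path(1)[of "D - 1" D] D_ge by simp
  qed
  then have "prod (deg G') ?N = prod (deg G) ?N"
    by (intro prod.cong refl deg_moved_other) auto
  then have "nbr_deg_prod G' (P ! 2) = prod (deg G) ?N"
    by (simp add: nbr_deg_prod_def nb split deg_moved_second)
  moreover have "nbr_deg_prod G (P ! 2) = Suc (card end_leaves) * prod (deg G) ?N"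
    by (simp add: nbr_deg_prod_def split deg_second)
  ultimately show ?thesis using that by blast
qed

text \<open>Likewise \<open>Y\<close> is the quotient at \<open>P ! (D - 2)\<close>, so the
  hypothesis of the theorem becomes \<open>X \<le> Y\<close>.\<close>

lemma nbr_deg_prod_third_last:
  obtains Y where "nbr_deg_prod G (P ! (D - 2)) = deg G (P ! (D - 1)) * Y"
    "nbr_deg_prod G' (P ! (D - 2)) = (deg G (P ! (D - 1)) + card end_leaves) * Y"
proof -
  let ?c = "P ! (D - 2)" and ?b = "P ! (D - 1)"
  let ?N = "neighbors G ?c - {?b}"
  have "?b \<in> neighbors G ?c"
    using second_last_neighbors(1) neighbors_sym[of ?b ?c] by simp
  then have split: "(\<Prod>v\<in>neighbors G ?c. f v) = f ?b * prod f ?N" for f :: "'a \<Rightarrow> nat"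
    by (simp add: finite_neighbors prod.remove)
  have c: "?c \<noteq> P ! 1" "?c \<noteq> P ! 2" "?c \<noteq> ?b" "?c \<notin> end_leaves"
    using D_ge by (simp_all add: path_eq_iff path_not_in_end_leaves)
  then have nb: "neighbors G' ?c = neighbors G ?c"
    by (intro neighbors_moved_other)
  have "P ! 1 \<notin> neighbors G ?c"
    using second_not_neighbor c by blast
  then have "prod (deg G') ?N = prod (deg G) ?N"
    by (intro prod.cong refl deg_moved_other) auto
  then have "nbr_deg_prod G' ?c = (deg G ?b + card end_leaves) * prod (deg G) ?N"
    by (simp add: nbr_deg_prod_def nb split deg_moved_second_last)
  moreover have "nbr_deg_prod G ?c = deg G ?b * prod (deg G) ?N"
    by (simp add: nbr_deg_prod_def split)
  ultimately show ?thesis using that by blast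
qed

section \<open>Comparison of the two sums\<close>

lemma frac_le_moved:
  assumes "u \<in> pverts G" "u \<noteq> P ! 2"
  shows "real (nbr_deg_prod G u) / real (ecc G u) \<le> real (nbr_deg_prod G' u) / real (ecc G' u)"
  using nbr_deg_prod_le_moved[OF assms(2)] ecc_moved_le[OF assms(1)] ecc_moved_pos[OF assms(1)]
  by (intro frac_le) auto

text \<open>The loss at \<open>P ! 2\<close> is compensated by the gain at \<open>P ! (D - 2)\<close>, since
  \<open>ecc (P ! (D - 2)) \<le> D - 2 \<le> ecc (P ! 2)\<close>.\<close>

lemma third_and_third_last_le_moved:
  assumes "real (nbr_deg_prod G (P ! 2)) / real (deg G (P ! 1))
           \<le> real (nbr_deg_prod G (P ! (D - 2))) / real (deg G (P ! (D - 1)))"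
  shows "real (nbr_deg_prod G (P ! 2)) / real (ecc G (P ! 2))
      + real (nbr_deg_prod G (P ! (D - 2))) / real (ecc G (P ! (D - 2)))
    \<le> real (nbr_deg_prod G' (P ! 2)) / real (ecc G' (P ! 2))
      + real (nbr_deg_prod G' (P ! (D - 2))) / real (ecc G' (P ! (D - 2)))"
proof -
  let ?k = "card end_leaves" and ?b = "deg G (P ! (D - 1))"
  let ?e2 = "ecc G (P ! 2)" and ?e3 = "ecc G (P ! (D - 2))"
  obtain X where X: "nbr_deg_prod G (P ! 2) = Suc ?k * X" "nbr_deg_prod G' (P ! 2) = X"
    by (rule nbr_deg_prod_third)
  obtain Y where Y: "nbr_deg_prod G (P ! (D - 2)) = ?b * Y"
    "nbr_deg_prod G' (P ! (D - 2)) = (?b + ?k) * Y"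
    by (rule nbr_deg_prod_third_last)
  have "X \<le> Y"
    using assms deg_second_last_ge unfolding X Y deg_second of_nat_mult by simp
  have V: "P ! 2 \<in> pverts G" "P ! (D - 2) \<in> pverts G"
    using path_in_verts D_ge by auto
  have "D - 2 \<le> ?e2"
    using vdist_path(1)[of 2 D] vdist_le_ecc[OF pair_finite_verts path_in_verts[of D], of "P ! 2"] D_ge
    by simp
  then have "?e3 \<le> ?e2"
    using ecc_third_last_le by simp
  have e3: "0 < ?e3"
    using ecc_moved_le[OF V(2)] ecc_moved_pos[OF V(2)] by simp
  \<comment> \<open>The left side is what \<open>P ! 2\<close> loses through the smaller product,
    the right side what \<open>P ! (D - 2)\<close> gains, both measured with the old
    eccentricities.\<close>
  have "real (?k * X) / real ?e2 \<le> real (?k * Y) / real ?e3"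
    using \<open>X \<le> Y\<close> \<open>?e3 \<le> ?e2\<close> e3 by (intro frac_le) (auto simp: mult_left_mono)
  moreover have "real X / real ?e2 \<le> real X / real (ecc G' (P ! 2))"
    using ecc_moved_le[OF V(1)] ecc_moved_pos[OF V(1)] by (intro frac_le) auto
  moreover have "real ((?b + ?k) * Y) / real ?e3 \<le> real ((?b + ?k) * Y) / real (ecc G' (P ! (D - 2)))"
    using ecc_moved_le[OF V(2)] ecc_moved_pos[OF V(2)] by (intro frac_le) auto
  moreover have "real (Suc ?k * X) / real ?e2 = real X / real ?e2 + real (?k * X) / real ?e2"
    by (simp add: add_divide_distrib distrib_right)
  moreover have "real ((?b + ?k) * Y) / real ?e3 = real (?b * Y) / real ?e3 + real (?k * Y) / real ?e3"
    by (simp add: add_divide_distrib distrib_right)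
  ultimately show ?thesis
    unfolding X Y by linarith
qed

lemma xi_ac_less_moved:
  assumes "real (nbr_deg_prod G (P ! 2)) / real (deg G (P ! 1))
           \<le> real (nbr_deg_prod G (P ! (D - 2))) / real (deg G (P ! (D - 1)))"
  shows "xi_ac G < xi_ac G'"
proof -
  define f where "f u = real (nbr_deg_prod G u) / real (ecc G u)" for u
  define f' where "f' u = real (nbr_deg_prod G' u) / real (ecc G' u)" for u
  \<comment> \<open>The summand at \<open>P ! 2\<close> may decrease, so these two vertices are
    compared jointly and all others termwise.\<close>
  let ?A = "{P ! 2, P ! (D - 2)}"
  have ne: "P ! 2 \<noteq> P ! (D - 2)" "P ! 0 \<noteq> P ! 2" "P ! 0 \<noteq> P ! (D - 2)"
    using D_ge by (simp_all add: path_eq_iff)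
  have "?A \<subseteq> pverts G"
    using path_in_verts D_ge by auto
  then have split: "sum g (pverts G) = sum g (pverts G - ?A) + (g (P ! 2) + g (P ! (D - 2)))"
    for g :: "'a \<Rightarrow> real"
    using sum.subset_diff[of ?A "pverts G" g] pair_finite_verts ne by simp
  have v0: "P ! 0 \<in> pverts G"
    using path_in_verts by simp
  \<comment> \<open>\<open>P ! 0\<close> is an end leaf outside \<open>?A\<close>, so its strict
    gain survives in the remaining sum.\<close>
  have "f (P ! 0) < f' (P ! 0)"
    unfolding f_def f'_def
    using nbr_deg_prod_moved_leaf[OF first_in_end_leaves] ecc_moved_le[OF v0] ecc_moved_pos[OF v0]
    by (intro frac_less) auto
  then have "sum f (pverts G - ?A) < sum f' (pverts G - ?A)"
    using frac_le_moved v0 ne pair_finite_verts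
    by (intro sum_strict_mono_ex1) (auto simp: f_def f'_def)
  moreover have "f (P ! 2) + f (P ! (D - 2)) \<le> f' (P ! 2) + f' (P ! (D - 2))"
    using third_and_third_last_le_moved[OF assms] by (simp add: f_def f'_def)
  ultimately have "sum f (pverts G) < sum f' (pverts G)"
    unfolding split[of f] split[of f'] by simp
  then show ?thesis
    by (simp add: xi_ac_def f_def f'_def)
qed

end

theorem theorem4:
  fixes T T' :: "'a pair_pre_digraph" and P :: "'a list" and n D :: nat
  assumes "undirected_tree T" and "card (pverts T) = n"
    and "D = diam T" and "D \<ge> 5"
    and "diametric_path T P"
    and "real (nbr_deg_prod T (P ! 2)) / real (deg T (P ! 1))
           \<le> real (nbr_deg_prod T (P ! (D - 2))) / real (deg T (P ! (D - 1)))"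
    and "T' = move_edges T (P ! 1) (P ! (D - 1)) (pendant_neighbors T (P ! 1))"
  shows "xi_ac T < xi_ac T'"
proof -
  interpret long_diametric_path T P D
    using assms by unfold_locales auto
  have "T' = G'"
    unfolding assms(7) G'_def pendant_neighbors_second ..
  then show ?thesis
    using xi_ac_less_moved[OF assms(6)] by simp
qed

end
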